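(* Consider second-order q-difference operators $W=A_1(x)T^{+}+A_2(x)T^{-}+A_0(x)\mathcal{I}$ with generic (a priori unrestricted) coefficients $A_0(x),A_1(x),A_2(x)$. The most general such operator $W$ which, for every $n=0,1,2,\dots$, sends any polynomial of degree $n$ to a polynomial of degree $n+1$ (meaning a polynomial of degree not exceeding $n+1$) is the one with coefficients $$A_1(x)=\frac{p_3(x)}{x^2},\qquad A_2(x)=\frac{q\,p_3(x)+x\,p_2(x)}{x^2},\qquad A_0(x)=-A_1(x)-A_2(x)+p_1(x),$$ where $p_1(x),p_2(x),p_3(x)$ are polynomials with $\deg p_i(x)\le i$. That is, $W$ has this property if and only if its coefficients are of this form for some such polynomials $p_1,p_2,p_3$.
   Context: $q$ is the base parameter. The q-shift operators are defined by $T^{+}f(x)=f(qx)$ and $T^{-}f(x)=f(x/q)$, and $\mathcal{I}$ is the identity operator. The operator $W$ with the coefficients given in the claim is called the big q-Heun operator. *)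

theory Defs
  imports "HOL-Computational_Algebra.Polynomial"
begin

definition T_plus :: "'a::field \<Rightarrow> ('a \<Rightarrow> 'a) \<Rightarrow> 'a \<Rightarrow> 'a" where
  "T_plus q f = (\<lambda>x. f (q * x))"

definition T_minus :: "'a::field \<Rightarrow> ('a \<Rightarrow> 'a) \<Rightarrow> 'a \<Rightarrow> 'a" where
  "T_minus q f = (\<lambda>x. f (x / q))"

definition q_difference_operator ::
  "'a::field \<Rightarrow> ('a \<Rightarrow> 'a) \<Rightarrow> ('a \<Rightarrow> 'a) \<Rightarrow> ('a \<Rightarrow> 'a) \<Rightarrow> ('a \<Rightarrow> 'a) \<Rightarrow> 'a \<Rightarrow> 'a" where
  "q_difference_operator q A1 A2 A0 f =
     (\<lambda>x. A1 x * T_plus q f x + A2 x * T_minus q f x + A0 x * f x)"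

(* D is the set of points at which the coefficients of the operator are defined, so an
   identity between functions of x means equality at every point of D.  For infinite D
   the polynomial g is determined by its values on D.  The zero polynomial has degree 0
   in the library; every linear W maps it to itself, so including it is harmless. *)
definition raises_degree_by_at_most_one ::
  "'a::field set \<Rightarrow> (('a \<Rightarrow> 'a) \<Rightarrow> 'a \<Rightarrow> 'a) \<Rightarrow> bool" where
  "raises_degree_by_at_most_one D W \<longleftrightarrow>
     (\<forall>n. \<forall>f. degree f = n \<longrightarrow>
        (\<exists>g. degree g \<le> n + 1 \<and> (\<forall>x\<in>D. W (poly f) x = poly g x)))"

end

theory Submission
  imports Defs
begin

text \<open>
  The monomials are joint eigenvectors of the two shifts, so on \<open>x ^ n\<close> the operator is
  multiplication by \<open>A1 q\<^sup>n + A2 q\<^sup>-\<^sup>n + A0\<close>, and by linearity it suffices to look at monomials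
  (\<open>raises_degree_iff_monomials\<close>).

  The conditions for \<open>n = 0, 1, 2\<close> alone determine the shape of the coefficients: they say
  that \<open>A1 + A2 + A0\<close>, \<open>x (A1 q + A2 / q + A0)\<close> and \<open>x\<^sup>2 (A1 q\<^sup>2 + A2 / q\<^sup>2 + A0)\<close> are polynomials
  \<open>g0, g1, g2\<close> of degrees at most 1, 2, 3.  This is a linear system for \<open>A1, A2, A0\<close> with a
  Vandermonde matrix in the nodes \<open>1, q, 1 / q\<close>, and these nodes are distinct precisely because
  \<open>q\<^sup>2 \<noteq> 1\<close>; solving it gives the polynomials \<open>p1, p2, p3\<close> (\<open>coefficients_from_low_degrees\<close>).

  Conversely, the coefficients have at worst a double pole at the origin, so for \<open>n \<ge> 2\<close> the
  factor \<open>x ^ n\<close> cancels it, and for \<open>n = 0\<close> the poles cancel since \<open>A1 + A2 + A0 = p1\<close>.  The case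
  \<open>n = 1\<close> is where the coupling of \<open>A1\<close> and \<open>A2\<close> matters: the contribution of \<open>p3\<close> is
  proportional to \<open>(q - 1) + q (1 / q - 1) = 0\<close> (\<open>heun_image_of_monomial\<close>).
\<close>

text \<open>Only the images of the monomials matter, because the bound \<open>n + 1\<close> is increasing in
  \<open>n\<close>: the images of the lower terms of a polynomial of degree \<open>n\<close> stay within it.\<close>

lemma raises_degree_iff_monomials:
  fixes q :: "'a::field" and A0 A1 A2 :: "'a \<Rightarrow> 'a"
  shows "raises_degree_by_at_most_one D (q_difference_operator q A1 A2 A0) \<longleftrightarrow>
    (\<forall>n. \<exists>g. degree g \<le> n + 1 \<and>
      (\<forall>x\<in>D. A1 x * (q * x) ^ n + A2 x * (x / q) ^ n + A0 x * x ^ n = poly g x))"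
    (is "_ \<longleftrightarrow> ?R")
proof
  assume L: "raises_degree_by_at_most_one D (q_difference_operator q A1 A2 A0)"
  show ?R
  proof
    fix n
    have "degree (monom (1::'a) n) = n"
      by (simp add: degree_monom_eq)
    with L show "\<exists>g. degree g \<le> n + 1 \<and>
      (\<forall>x\<in>D. A1 x * (q * x) ^ n + A2 x * (x / q) ^ n + A0 x * x ^ n = poly g x)"
      unfolding raises_degree_by_at_most_one_def q_difference_operator_def
        T_plus_def T_minus_def
      by (metis (no_types, lifting) poly_monom mult_1)
  qed
next
  assume ?R
  then obtain g where deg: "\<And>n. degree (g n) \<le> n + 1"
    and g: "\<And>n x. x \<in> D \<Longrightarrow>
      A1 x * (q * x) ^ n + A2 x * (x / q) ^ n + A0 x * x ^ n = poly (g n) x"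
    by metis
  show "raises_degree_by_at_most_one D (q_difference_operator q A1 A2 A0)"
    unfolding raises_degree_by_at_most_one_def
  proof (intro allI impI)
    fix n and f :: "'a poly"
    assume n: "degree f = n"
    define h where "h = (\<Sum>i\<le>n. smult (coeff f i) (g i))"
    have "degree h \<le> n + 1"
      unfolding h_def
    proof (rule degree_sum_le)
      fix i assume "i \<in> {..n}"
      then show "degree (smult (coeff f i) (g i)) \<le> n + 1"
        using deg[of i] degree_smult_le[of "coeff f i" "g i"] by simp
    qed simp
    moreover have "q_difference_operator q A1 A2 A0 (poly f) x = poly h x" if "x \<in> D" for x
    proof -
      have f: "poly f y = (\<Sum>i\<le>n. coeff f i * y ^ i)" for y
        by (simp add: poly_altdef n)
      show ?thesis
        unfolding q_difference_operator_def T_plus_def T_minus_def f h_def poly_sum poly_smult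
          g[OF that, symmetric]
        by (simp add: sum_distrib_left sum.distrib algebra_simps)
    qed
    ultimately show "\<exists>g. degree g \<le> n + 1 \<and>
        (\<forall>x\<in>D. q_difference_operator q A1 A2 A0 (poly f) x = poly g x)"
      by blast
  qed
qed

text \<open>Eliminating \<open>a0\<close> by means of \<open>g0\<close> and then \<open>a2\<close> leaves \<open>a1\<close> with the denominators
  \<open>q - 1\<close>, \<open>q\<^sup>2 - 1\<close> and \<open>q\<^sup>2 - q\<close>, the differences of the nodes of the Vandermonde system up to powers
  of \<open>q\<close>.\<close>

lemma coefficients_from_low_degrees:
  fixes q x a0 a1 a2 g0 g1 g2 p2 p3 :: "'a::field"
  assumes "q \<noteq> 0" "q\<^sup>2 \<noteq> 1" "x \<noteq> 0"
    and g0: "a1 + a2 + a0 = g0"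
    and g1: "a1 * (q * x) + a2 * (x / q) + a0 * x = g1"
    and g2: "a1 * (q * x)\<^sup>2 + a2 * (x / q)\<^sup>2 + a0 * x\<^sup>2 = g2"
    and p2: "p2 = - (q / (q - 1)) * (g1 - x * g0)"
    and p3: "p3 = (q\<^sup>2 / (q\<^sup>2 - 1) * (g2 - x\<^sup>2 * g0) + x * p2) / (q\<^sup>2 - q)"
  shows "a1 = p3 / x\<^sup>2" "a2 = (q * p3 + x * p2) / x\<^sup>2"
proof -
  have q1: "q \<noteq> 1"
    using \<open>q\<^sup>2 \<noteq> 1\<close> by auto
  have nz: "q - 1 \<noteq> 0" "q\<^sup>2 - 1 \<noteq> 0"
    using q1 \<open>q\<^sup>2 \<noteq> 1\<close> by simp_all
  have "q\<^sup>2 - q = q * (q - 1)"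
    by (simp add: power2_eq_square algebra_simps)
  then have nz': "q\<^sup>2 - q \<noteq> 0"
    using \<open>q \<noteq> 0\<close> nz by simp
  have d1: "q * (g1 - x * g0) = (q - 1) * (x * (q * a1 - a2))"
    unfolding g0[symmetric] g1[symmetric] using \<open>q \<noteq> 0\<close> by (simp add: field_simps)
  have d2: "q\<^sup>2 * (g2 - x\<^sup>2 * g0) = (q\<^sup>2 - 1) * (x\<^sup>2 * (q\<^sup>2 * a1 - a2))"
    unfolding g0[symmetric] g2[symmetric] using \<open>q \<noteq> 0\<close>
    by (simp add: field_simps power2_eq_square)
  have p2': "p2 = - (x * (q * a1 - a2))"
    using d1 nz by (simp add: p2)
  have "q\<^sup>2 / (q\<^sup>2 - 1) * (g2 - x\<^sup>2 * g0) = x\<^sup>2 * (q\<^sup>2 * a1 - a2)"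
    using d2 nz by simp
  then have "p3 = (x\<^sup>2 * (q\<^sup>2 * a1 - a2) + x * p2) / (q\<^sup>2 - q)"
    by (simp add: p3)
  also have "x\<^sup>2 * (q\<^sup>2 * a1 - a2) + x * p2 = (q\<^sup>2 - q) * (x\<^sup>2 * a1)"
    by (simp add: p2' power2_eq_square algebra_simps)
  finally have p3': "p3 = x\<^sup>2 * a1"
    using nz' by simp
  show "a1 = p3 / x\<^sup>2"
    using \<open>x \<noteq> 0\<close> by (simp add: p3')
  have "q * p3 + x * p2 = x\<^sup>2 * a2"
    by (simp add: p2' p3' power2_eq_square algebra_simps)
  then show "a2 = (q * p3 + x * p2) / x\<^sup>2"
    using \<open>x \<noteq> 0\<close> by simp
qed

lemma heun_image_of_monomial:
  fixes q :: "'a::field" and p1 p2 p3 :: "'a poly"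
  assumes "q \<noteq> 0" and deg: "degree p1 \<le> 1" "degree p2 \<le> 2" "degree p3 \<le> 3"
  obtains g where "degree g \<le> n + 1"
    and "\<And>x a0 a1 a2. \<lbrakk>x \<noteq> 0; a1 = poly p3 x / x\<^sup>2; a2 = (q * poly p3 x + x * poly p2 x) / x\<^sup>2;
           a0 = - a1 - a2 + poly p1 x\<rbrakk>
         \<Longrightarrow> a1 * (q * x) ^ n + a2 * (x / q) ^ n + a0 * x ^ n = poly g x"
proof -
  consider "n = 0" | "n = 1" | m where "n = m + 2"
    by (metis One_nat_def Suc_1 add.commute add_2_eq_Suc not0_implies_Suc)
  then show thesis
  proof cases
    case 1
    show thesis
      by (rule that[of p1]) (use 1 deg in auto)
  next
    case 2
    show thesis
    proof (rule that[of "pCons 0 p1 + smult (1 / q - 1) p2"])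
      show "degree (pCons 0 p1 + smult (1 / q - 1) p2) \<le> n + 1"
        using deg 2 degree_smult_le[of "1 / q - 1" p2]
        by (intro degree_add_le) (auto simp: degree_pCons_eq_if)
    next
      fix x a0 a1 a2 :: 'a
      assume *: "x \<noteq> 0" "a1 = poly p3 x / x\<^sup>2" "a2 = (q * poly p3 x + x * poly p2 x) / x\<^sup>2"
        "a0 = - a1 - a2 + poly p1 x"
      show "a1 * (q * x) ^ n + a2 * (x / q) ^ n + a0 * x ^ n
          = poly (pCons 0 p1 + smult (1 / q - 1) p2) x"
        unfolding *(4) unfolding *(2,3) using \<open>q \<noteq> 0\<close> \<open>x \<noteq> 0\<close> 2
        by (simp add: field_simps power2_eq_square)
    qed
  next
    case (3 m)
    define r where "r = smult (q ^ n - 1) p3 + smult ((1 / q) ^ n - 1) (smult q p3 + pCons 0 p2)"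
    have "degree (pCons 0 p2) \<le> 3"
      using deg by (simp add: degree_pCons_eq_if)
    then have "degree r \<le> 3"
      unfolding r_def using deg
      by (intro degree_add_le order_trans[OF degree_smult_le])
    then have "degree (monom 1 m * r) \<le> n + 1"
      using degree_mult_le[of "monom 1 m" r] degree_monom_le[of "1::'a" m] 3 by linarith
    moreover have "degree (monom 1 n * p1) \<le> n + 1"
      using degree_mult_le[of "monom 1 n" p1] degree_monom_le[of "1::'a" n] deg(1) by linarith
    ultimately have "degree (monom 1 n * p1 + monom 1 m * r) \<le> n + 1"
      by (intro degree_add_le)
    then show thesis
    proof (rule that)
      fix x a0 a1 a2 :: 'a
      assume *: "x \<noteq> 0" "a1 = poly p3 x / x\<^sup>2" "a2 = (q * poly p3 x + x * poly p2 x) / x\<^sup>2"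
        "a0 = - a1 - a2 + poly p1 x"
      have s: "a1 * x ^ n = x ^ m * poly p3 x"
        "a2 * x ^ n = x ^ m * (q * poly p3 x + x * poly p2 x)"
        unfolding *(2,3) 3 power_add using \<open>x \<noteq> 0\<close> by simp_all
      have "a1 * (q * x) ^ n + a2 * (x / q) ^ n + a0 * x ^ n
          = x ^ n * poly p1 x + ((q ^ n - 1) * (a1 * x ^ n) + ((1 / q) ^ n - 1) * (a2 * x ^ n))"
        unfolding *(4) by (simp add: power_mult_distrib power_divide algebra_simps)
      also have "\<dots> = poly (monom 1 n * p1 + monom 1 m * r) x"
        unfolding s by (simp add: r_def poly_monom algebra_simps)
      finally show "a1 * (q * x) ^ n + a2 * (x / q) ^ n + a0 * x ^ n
          = poly (monom 1 n * p1 + monom 1 m * r) x" .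
    qed
  qed
qed

theorem mainTheorem1:
  fixes q :: "'a::field_char_0"
    and D :: "'a set"
    and A0 A1 A2 :: "'a \<Rightarrow> 'a"
  assumes "q \<noteq> 0" and "q\<^sup>2 \<noteq> 1"
    and "infinite D" and "0 \<notin> D"
  shows "raises_degree_by_at_most_one D (q_difference_operator q A1 A2 A0) \<longleftrightarrow>
    (\<exists>p1 p2 p3 :: 'a poly. degree p1 \<le> 1 \<and> degree p2 \<le> 2 \<and> degree p3 \<le> 3 \<and>
      (\<forall>x\<in>D. A1 x = poly p3 x / x\<^sup>2 \<and>
             A2 x = (q * poly p3 x + x * poly p2 x) / x\<^sup>2 \<and>
             A0 x = - A1 x - A2 x + poly p1 x))"
    (is "?L \<longleftrightarrow> ?R")
proof
  assume ?L
  then obtain g where deg: "\<And>n. degree (g n) \<le> n + 1"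
    and g: "\<And>n x. x \<in> D \<Longrightarrow>
      A1 x * (q * x) ^ n + A2 x * (x / q) ^ n + A0 x * x ^ n = poly (g n) x"
    unfolding raises_degree_iff_monomials by metis
  define p2 where "p2 = smult (- (q / (q - 1))) (g 1 - pCons 0 (g 0))"
  define p3 where "p3 = smult (1 / (q\<^sup>2 - q))
    (smult (q\<^sup>2 / (q\<^sup>2 - 1)) (g 2 - pCons 0 (pCons 0 (g 0))) + pCons 0 p2)"
  have d: "degree (g 0) \<le> 1" "degree (g 1) \<le> 2" "degree (g 2) \<le> 3"
    using deg[of 0] deg[of 1] deg[of 2] by simp_all
  have d2: "degree p2 \<le> 2"
    unfolding p2_def using d
    by (intro order_trans[OF degree_smult_le] degree_diff_le) (auto simp: degree_pCons_eq_if)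
  then have "degree (pCons 0 p2) \<le> 3"
    by (simp add: degree_pCons_eq_if)
  then have d3: "degree p3 \<le> 3"
    unfolding p3_def using d
    by (intro order_trans[OF degree_smult_le] degree_add_le degree_diff_le)
      (auto simp: degree_pCons_eq_if)
  have "A1 x = poly p3 x / x\<^sup>2 \<and> A2 x = (q * poly p3 x + x * poly p2 x) / x\<^sup>2 \<and>
      A0 x = - A1 x - A2 x + poly (g 0) x" if "x \<in> D" for x
  proof -
    have "x \<noteq> 0"
      using that \<open>0 \<notin> D\<close> by auto
    have g0: "A1 x + A2 x + A0 x = poly (g 0) x"
      using g[OF that, of 0] by simp
    have g1: "A1 x * (q * x) + A2 x * (x / q) + A0 x * x = poly (g 1) x"
      using g[OF that, of 1] by simp
    have "poly p2 x = - (q / (q - 1)) * (poly (g 1) x - x * poly (g 0) x)"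
      by (simp add: p2_def)
    moreover have "poly p3 x =
        (q\<^sup>2 / (q\<^sup>2 - 1) * (poly (g 2) x - x\<^sup>2 * poly (g 0) x) + x * poly p2 x) / (q\<^sup>2 - q)"
      by (simp add: p3_def power2_eq_square mult.assoc)
    ultimately show ?thesis
      using coefficients_from_low_degrees[OF \<open>q \<noteq> 0\<close> \<open>q\<^sup>2 \<noteq> 1\<close> \<open>x \<noteq> 0\<close> g0 g1 g[OF that]] g0
      by (simp add: algebra_simps)
  qed
  with d d2 d3 show ?R
    by blast
next
  assume ?R
  then obtain p1 p2 p3 :: "'a poly"
    where deg: "degree p1 \<le> 1" "degree p2 \<le> 2" "degree p3 \<le> 3"
      and A: "\<And>x. x \<in> D \<Longrightarrow> A1 x = poly p3 x / x\<^sup>2"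
        "\<And>x. x \<in> D \<Longrightarrow> A2 x = (q * poly p3 x + x * poly p2 x) / x\<^sup>2"
        "\<And>x. x \<in> D \<Longrightarrow> A0 x = - A1 x - A2 x + poly p1 x"
    by blast
  show ?L
    unfolding raises_degree_iff_monomials
  proof
    fix n
    obtain g where "degree g \<le> n + 1"
      and g: "\<And>x a0 a1 a2. \<lbrakk>x \<noteq> 0; a1 = poly p3 x / x\<^sup>2;
          a2 = (q * poly p3 x + x * poly p2 x) / x\<^sup>2; a0 = - a1 - a2 + poly p1 x\<rbrakk>
        \<Longrightarrow> a1 * (q * x) ^ n + a2 * (x / q) ^ n + a0 * x ^ n = poly g x"
      using heun_image_of_monomial[OF \<open>q \<noteq> 0\<close> deg] by metis
    moreover have "A1 x * (q * x) ^ n + A2 x * (x / q) ^ n + A0 x * x ^ n = poly g x"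
      if "x \<in> D" for x
      using that \<open>0 \<notin> D\<close> by (intro g A) auto
    ultimately show "\<exists>g. degree g \<le> n + 1 \<and>
      (\<forall>x\<in>D. A1 x * (q * x) ^ n + A2 x * (x / q) ^ n + A0 x * x ^ n = poly g x)"
      by blast
  qed
qed

end
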